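(* Let $p$ be an odd prime and let $k$ be an integer with $1\le k<p/2$. Let $m\ge1$ and let $n_1,\dots,n_m$ be integers with $1<n_1<n_2<\dots<n_m$ and $n_{i+1}-n_i\ge3$ for $1\le i<m$. Put $l=n_m$, $l_1=n_1-1$ and $l_{i+1}=n_{i+1}-n_i-1$ for $1\le i<m$. Let $\alpha=[a_1,a_2,\dots,a_n,\dots]\in\mathbb{F}_p((T^{-1}))$ be a $P_k$-expansion of second kind defined by an $(l+2)$-tuple $(a_1,\dots,a_l,\epsilon_1,\epsilon_2)$, and suppose it is perfect with the following pattern: there is a sequence $(\lambda_n)_{n\ge1}$ in $\mathbb{F}_p^*$ such that $a_n=\lambda_nB_{i(n)}$ for all $n\ge1$, where $(i(n))_{n\ge1}$ is the sequence of letters of the infinite word $$V_0,V_1,V_2,\dots,V_n,\dots$$ with $$V_0=0^{[l_1]},1,0^{[l_2]},1,\dots,1,0^{[l_m]},1,\qquad V_n=V_{n,1},V_{n,2},\dots,V_{n,m}\quad(n\ge1),$$ $$V_{n,i}=(2n,2n-1,J_n^{[2k-1]})^{[l_i-1]},2n,2n+1\quad(1\le i\le m,\ n\ge1),$$ and $J_1=0^{[2k]},1$, $\ J_{n+1}=(2n,2n-1,J_n^{[2k-1]})^{[2k-1]},2n,2n+1$ for $n\ge1$. Set $$\nu_1=m(p-2k-1)+l,\qquad \nu_2=\nu_1+l_1(p^2-1)-2k(p-1).$$ Then the irrationality measure of $\alpha$ is $\nu(\alpha)=2+\nu_0(\alpha)$ with $$\nu_0(\alpha)=(p-1)(p-2k+1)\max\left(\frac1{\nu_1},\frac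 p{\nu_2}\right).$$ Consequently, $\nu_0(\alpha)=p-1$ if $m=1$ and $l=2$, and $\nu_0(\alpha)<p-1$ otherwise.
   Context: $\mathbb{F}_p((T^{-1}))$ is the field of power series in $1/T$ over $\mathbb{F}_p$, with the ultrametric absolute value $|\sum_{i\le i_0}u_iT^i|=|T|^{i_0}$ if $u_{i_0}\ne0$, where $|T|>1$ is a fixed real number. Every irrational element $\alpha$ with $|\alpha|>1$ has a unique infinite continued fraction expansion $\alpha=[a_1,a_2,\dots]$ with $a_i\in\mathbb{F}_p[T]$ non-constant; $\alpha_{n+1}=[a_{n+1},a_{n+2},\dots]$ denotes its tail. The irrationality measure of an irrational $\alpha$ is $\nu(\alpha)=\limsup_{|Q|\to\infty}\bigl(-\log|\alpha-P/Q|/\log|Q|\bigr)$, over $P,Q\in\mathbb{F}_p[T]$, $Q\neq 0$. Set $P_k=(T^2-1)^k\in\mathbb{F}_p[T]$ and $Q_k=\int_0^T(x^2-1)^{k-1}dx=\sum_{0\le i\le k-1}(-1)^{k-1-i}\binom{k-1}{i}(2i+1)^{-1}T^{2i+1}\in\mathbb{F}_p[T]$. The polynomials $B_n\in\mathbb{F}_p[T]$ are defined by $B_0=T$, $B_1=[T^p/P_k]$ (here the bracket denotes the polynomial part of a rational function), and $B_{n+1}=B_n^pP_k^{(-1)^{n+1}}$ for $n\ge1$ (these are polynomials). A $P_k$-expansion of second kind defined by $(a_1,\dots,a_l,\epsilon_1,\epsilon_2)$, where the $a_i\in\mathbb{F}_p[T]$ are non-constant and $\epsilon_1,\epsilon_2\in\mathbb{F}_p^*$,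 is the (unique) infinite continued fraction $\alpha$ with $|\alpha|>1$ whose first $l$ partial quotients are $a_1,\dots,a_l$ and which satisfies $\alpha^{p^2}=\epsilon_1P_k^{p-1}\alpha_{l+1}+\epsilon_2Q_k^p$. Words are finite or infinite sequences of non-negative integers; commas denote concatenation, and $W^{[n]}$ denotes the word $W$ repeated $n$ times ($W^{[0]}$ is empty). *)

theory Defs
  imports
    "Berlekamp_Zassenhaus.Finite_Field"
    "HOL-Computational_Algebra.Formal_Laurent_Series"
    "HOL-Analysis.Extended_Real_Limits"
    "HOL-Library.Stream"
begin

text \<open>
  The prime field with \<open>p\<close> elements is \<open>'p mod_ring\<close> with \<open>p = CARD('p)\<close> and \<open>'p :: prime_card\<close>.
  An element of \<open>'a fls\<close> is read as a power series in \<open>1/T\<close>: the library's variable \<open>fls_X\<close>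
  is \<open>1/T\<close>, so \<open>fls_X_inv\<close> is \<open>T\<close> and the coefficient of \<open>T^i\<close> in \<open>f\<close> is \<open>fls_nth f (- i)\<close>.
\<close>

definition of_pol :: "'a::field poly \<Rightarrow> 'a fls" where
  "of_pol P = poly (map_poly fls_const P) fls_X_inv"

text \<open>\<open>fls_prpart\<close> collects the coefficients of the strictly positive powers of \<open>T\<close> only.\<close>

definition pol_part :: "'a::field fls \<Rightarrow> 'a poly" where
  "pol_part f = fls_prpart f + [:fls_nth f 0:]"

text \<open>The parameter \<open>t\<close> is the fixed real number \<open>|T| > 1\<close>.\<close>

definition absv :: "real \<Rightarrow> 'a::field fls \<Rightarrow> real" where
  "absv t f = (if f = 0 then 0 else t powi (- fls_subdegree f))"

definition irrational :: "'a::field fls \<Rightarrow> bool" where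
  "irrational \<alpha> \<longleftrightarrow> (\<forall>P Q. Q \<noteq> 0 \<longrightarrow> \<alpha> \<noteq> of_pol P / of_pol Q)"

text \<open>
  \<open>cf_tail \<alpha> n\<close> is what remains of the continued fraction after its first \<open>n\<close> partial
  quotients, i.e. \<open>\<alpha>\<^sub>n\<^sub>+\<^sub>1 = [a\<^sub>n\<^sub>+\<^sub>1, a\<^sub>n\<^sub>+\<^sub>2, \<dots>]\<close>.  Partial quotients are numbered
  from \<open>1\<close>; the value of \<open>a\<close> at \<open>0\<close> is irrelevant in \<open>has_cf\<close>.
\<close>

primrec cf_tail :: "'a::field fls \<Rightarrow> nat \<Rightarrow> 'a fls" where
  "cf_tail \<alpha> 0 = \<alpha>"
| "cf_tail \<alpha> (Suc n) = 1 / (cf_tail \<alpha> n - of_pol (pol_part (cf_tail \<alpha> n)))"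

definition partial_quotient :: "'a::field fls \<Rightarrow> nat \<Rightarrow> 'a poly" where
  "partial_quotient \<alpha> n = pol_part (cf_tail \<alpha> (n - 1))"

definition has_cf :: "real \<Rightarrow> 'a::field fls \<Rightarrow> (nat \<Rightarrow> 'a poly) \<Rightarrow> bool" where
  "has_cf t \<alpha> a \<longleftrightarrow> irrational \<alpha> \<and> absv t \<alpha> > 1 \<and> (\<forall>n\<ge>1. a n = partial_quotient \<alpha> n)"

definition irrationality_measure :: "real \<Rightarrow> 'a::field fls \<Rightarrow> ereal" where
  "irrationality_measure t \<alpha> =
     Limsup (filtercomap (\<lambda>(P, Q). absv t (of_pol Q)) at_top)
       (\<lambda>(P, Q). ereal (- ln (absv t (\<alpha> - of_pol P / of_pol Q)) / ln (absv t (of_pol Q))))"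

definition Ppol :: "nat \<Rightarrow> 'a::field poly" where
  "Ppol k = (monom 1 2 - 1) ^ k"

definition Qpol :: "nat \<Rightarrow> 'a::field poly" where
  "Qpol k = (\<Sum>i\<le>k - 1. monom ((- 1) ^ (k - 1 - i) * of_nat ((k - 1) choose i)
               * inverse (of_nat (2 * i + 1))) (2 * i + 1))"

text \<open>The polynomial division \<open>div\<close> by \<open>Ppol k\<close> below is exact.\<close>

fun Bpol :: "nat \<Rightarrow> nat \<Rightarrow> 'p::prime_card mod_ring poly" where
  "Bpol k 0 = monom 1 1"
| "Bpol k (Suc 0) = pol_part (of_pol (monom 1 CARD('p)) / of_pol (Ppol k))"
| "Bpol k (Suc (Suc n)) =
     (if odd (Suc n) then Bpol k (Suc n) ^ CARD('p) * Ppol k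
      else Bpol k (Suc n) ^ CARD('p) div Ppol k)"

definition expansion_second_kind ::
    "real \<Rightarrow> nat \<Rightarrow> 'p mod_ring poly list \<Rightarrow> 'p mod_ring \<Rightarrow> 'p mod_ring
       \<Rightarrow> 'p::prime_card mod_ring fls \<Rightarrow> bool" where
  "expansion_second_kind t k as \<epsilon>1 \<epsilon>2 \<alpha> \<longleftrightarrow>
     (\<forall>a \<in> set as. degree a > 0) \<and> \<epsilon>1 \<noteq> 0 \<and> \<epsilon>2 \<noteq> 0 \<and>
     irrational \<alpha> \<and> absv t \<alpha> > 1 \<and>
     as = map (partial_quotient \<alpha>) [1..<Suc (length as)] \<and>
     \<alpha> ^ (CARD('p) ^ 2) =
       fls_const \<epsilon>1 * of_pol (Ppol k) ^ (CARD('p) - 1) * cf_tail \<alpha> (length as)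
       + fls_const \<epsilon>2 * of_pol (Qpol k) ^ CARD('p)"

definition wpow :: "'a list \<Rightarrow> nat \<Rightarrow> 'a list" where
  "wpow w n = concat (replicate n w)"

text \<open>\<open>J\<^sub>n\<close> is only used for \<open>n \<ge> 1\<close>.\<close>

fun Jword :: "nat \<Rightarrow> nat \<Rightarrow> nat list" where
  "Jword k 0 = []"
| "Jword k (Suc 0) = wpow [0] (2 * k) @ [1]"
| "Jword k (Suc (Suc n)) =
     (let N = Suc n in
      wpow ([2 * N, 2 * N - 1] @ wpow (Jword k N) (2 * k - 1)) (2 * k - 1) @ [2 * N, 2 * N + 1])"

definition Vblock :: "nat \<Rightarrow> (nat \<Rightarrow> nat) \<Rightarrow> nat \<Rightarrow> nat \<Rightarrow> nat list" where
  "Vblock k ls n i =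
     wpow ([2 * n, 2 * n - 1] @ wpow (Jword k n) (2 * k - 1)) (ls i - 1) @ [2 * n, 2 * n + 1]"

definition Vword :: "nat \<Rightarrow> nat \<Rightarrow> (nat \<Rightarrow> nat) \<Rightarrow> nat \<Rightarrow> nat list" where
  "Vword k m ls n =
     (if n = 0 then concat (map (\<lambda>i. wpow [0] (ls i) @ [1]) [1..<Suc m])
      else concat (map (Vblock k ls n) [1..<Suc m]))"

text \<open>
  The letters of the infinite word \<open>V\<^sub>0, V\<^sub>1, \<dots>\<close>, numbered from \<open>1\<close>.  All the words
  \<open>V\<^sub>n\<close> are nonempty when \<open>m \<ge> 1\<close>, which \<open>flat\<close> requires.
\<close>

definition letter :: "nat \<Rightarrow> nat \<Rightarrow> (nat \<Rightarrow> nat) \<Rightarrow> nat \<Rightarrow> nat" where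
  "letter k m ls n = flat (smap (Vword k m ls) nats) !! (n - 1)"

end

theory Submission
  imports Defs
begin

text \<open>
  Over \<open>F\<^sub>p((1/T))\<close> the error of a convergent is \<open>|\<alpha> - p\<^sub>n/q\<^sub>n| = |q\<^sub>n q\<^sub>n\<^sub>+\<^sub>1|\<inverse>\<close>, and a fraction with
  denominator of degree between \<open>deg q\<^sub>n\<close> and \<open>deg q\<^sub>n\<^sub>+\<^sub>1\<close> either equals \<open>p\<^sub>n/q\<^sub>n\<close> or has exponent at
  most 2.  Hence the irrationality measure is
  \<open>2 + limsup deg a\<^sub>n\<^sub>+\<^sub>1 / (deg a\<^sub>2 + \<dots> + deg a\<^sub>n)\<close>, and only the degrees of the partial quotients matter.
  The degree of \<open>B\<^sub>n\<close> is \<open>((p + 1 - 2k) p\<^sup>n + 2k (-1)\<^sup>n) / (p + 1)\<close>, whence \<open>J\<^sub>n\<close> has total degree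
  \<open>p\<^sup>2\<^sup>n\<^sup>-\<^sup>1\<close> and \<open>V\<^sub>n\<close> has total degree \<open>\<nu>\<^sub>1 p\<^sup>2\<^sup>n\<close>.  Inside \<open>V\<^sub>n\<close> the ratio is largest at the first letter \<open>2n\<close>
  or at the first letter \<open>2n + 1\<close>, and these two ratios converge to the two candidates for \<open>\<nu>\<^sub>0\<close>.
\<close>

section \<open>Polynomials as Laurent series in the inverse variable\<close>

lemma of_pol_0 [simp]: "of_pol 0 = 0"
  by (simp add: of_pol_def)

lemma of_pol_pCons: "of_pol (pCons c P) = fls_const c + fls_X_inv * of_pol P"
  by (cases "c = 0 \<and> P = 0") (auto simp: of_pol_def map_poly_pCons)

text \<open>The coefficient of T^n sits at index -n. Additivity, injectivity and the degree formula
  below are read off from this coefficientwise.\<close>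

lemma of_pol_nth: "fls_nth (of_pol P) i = (if i \<le> 0 then coeff P (nat (- i)) else 0)"
proof (induction P arbitrary: i)
  case 0
  then show ?case by simp
next
  case (pCons c P)
  show ?case
  proof (cases "i < 0")
    case True
    then have "nat (- i) = Suc (nat (- (i + 1)))" by simp
    with True show ?thesis
      by (simp add: of_pol_pCons pCons.IH fls_X_inv_times_conv_shift)
  next
    case False
    then show ?thesis
      by (simp add: of_pol_pCons pCons.IH fls_X_inv_times_conv_shift coeff_pCons)
  qed
qed

lemma of_pol_add: "of_pol (P + Q) = of_pol P + of_pol Q"
  by (rule fls_eqI) (simp add: of_pol_nth)

lemma of_pol_diff: "of_pol (P - Q) = of_pol P - of_pol Q"
  by (rule fls_eqI) (simp add: of_pol_nth)

lemma of_pol_smult: "of_pol (smult c P) = fls_const c * of_pol P"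
  by (rule fls_eqI) (simp add: of_pol_nth)

lemma of_pol_mult: "of_pol (P * Q) = of_pol P * of_pol Q"
  by (induction P) (simp_all add: of_pol_add of_pol_smult of_pol_pCons algebra_simps)

lemma of_pol_1 [simp]: "of_pol 1 = 1"
  by (simp add: of_pol_def)

lemma of_pol_eq_0_iff [simp]: "of_pol P = 0 \<longleftrightarrow> P = 0"
proof
  assume "of_pol P = 0"
  then have "coeff P n = 0" for n
    using of_pol_nth[of P "- int n"] by simp
  then show "P = 0" by (simp add: poly_eq_iff)
qed simp

lemma fls_subdegree_of_pol: "fls_subdegree (of_pol P) = - int (degree P)"
proof (cases "P = 0")
  case False
  show ?thesis
  proof (rule fls_subdegree_eqI)
    show "fls_nth (of_pol P) (- int (degree P)) \<noteq> 0"
      using False by (simp add: of_pol_nth)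
    show "fls_nth (of_pol P) i = 0" if "i < - int (degree P)" for i
    proof -
      from that have "degree P < nat (- i)" by simp
      then show ?thesis by (simp add: of_pol_nth coeff_eq_0)
    qed
  qed
qed simp

lemma coeff_pol_part: "coeff (pol_part f) n = fls_nth f (- int n)"
  by (simp add: pol_part_def coeff_pCons split: nat.splits)

text \<open>The hypothesis says that f is zero or has absolute value at least 1, so its leading term
  survives in the polynomial part.\<close>

lemma degree_pol_part:
  assumes "fls_subdegree f \<le> 0"
  shows "degree (pol_part f) = nat (- fls_subdegree f)"
proof (cases "f = 0")
  case True
  then show ?thesis by (simp add: pol_part_def)
next
  case False
  show ?thesis
  proof (rule antisym)
    show "degree (pol_part f) \<le> nat (- fls_subdegree f)"
      by (rule degree_le) (auto simp: coeff_pol_part)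
    show "nat (- fls_subdegree f) \<le> degree (pol_part f)"
      using False assms by (intro le_degree) (simp add: coeff_pol_part)
  qed
qed

lemma fls_subdegree_frac_part:
  assumes "f \<noteq> of_pol (pol_part f)"
  shows "fls_subdegree (f - of_pol (pol_part f)) \<ge> 1"
  using assms by (intro fls_subdegree_geI) (auto simp: of_pol_nth coeff_pol_part)

lemma ln_absv:
  assumes "t > 1" "f \<noteq> 0"
  shows "ln (absv t f) = - of_int (fls_subdegree f) * ln t"
  using assms by (simp add: absv_def ln_powr flip: powr_real_of_int')

section \<open>Convergents\<close>

text \<open>The quotient \<open>cf_num \<alpha> n / cf_den \<alpha> n\<close> stands for
  [a_1, ..., a_n], so index 0 is the formal convergent 1/0 and index 1 is a_1/1.\<close>

fun cf_num :: "'a::field fls \<Rightarrow> nat \<Rightarrow> 'a poly" where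
  "cf_num \<alpha> 0 = 1"
| "cf_num \<alpha> (Suc 0) = partial_quotient \<alpha> 1"
| "cf_num \<alpha> (Suc (Suc n)) = partial_quotient \<alpha> (Suc (Suc n)) * cf_num \<alpha> (Suc n) + cf_num \<alpha> n"

fun cf_den :: "'a::field fls \<Rightarrow> nat \<Rightarrow> 'a poly" where
  "cf_den \<alpha> 0 = 0"
| "cf_den \<alpha> (Suc 0) = 1"
| "cf_den \<alpha> (Suc (Suc n)) = partial_quotient \<alpha> (Suc (Suc n)) * cf_den \<alpha> (Suc n) + cf_den \<alpha> n"

definition cf_err :: "'a::field fls \<Rightarrow> nat \<Rightarrow> 'a fls" where
  "cf_err \<alpha> n = of_pol (cf_den \<alpha> n) * \<alpha> - of_pol (cf_num \<alpha> n)"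

lemma irrational_linear_nonzero:
  assumes "irrational \<alpha>" "Q \<noteq> 0"
  shows "of_pol Q * \<alpha> - of_pol P \<noteq> 0"
proof
  assume "of_pol Q * \<alpha> - of_pol P = 0"
  with assms have "\<alpha> = of_pol P / of_pol Q" by (simp add: field_simps)
  with assms show False by (auto simp: irrational_def)
qed

text \<open>All these facts share one induction because each feeds the next: irrationality keeps the
  error nonzero, so the tail is not a polynomial, so the next partial quotient is non-constant, so
  the denominator degree grows and fixes the size of the error. The sum starts at 2 because a_1
  enters only the numerators.\<close>

lemma convergent_invariants:
  assumes irr: "irrational \<alpha>"
  shows "cf_err \<alpha> n \<noteq> 0 \<and>
    cf_err \<alpha> (Suc n) = (of_pol (partial_quotient \<alpha> (Suc n)) - cf_tail \<alpha> n) * cf_err \<alpha> n \<and>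
    cf_den \<alpha> (Suc n) \<noteq> 0 \<and> degree (cf_den \<alpha> n) \<le> degree (cf_den \<alpha> (Suc n)) \<and>
    degree (partial_quotient \<alpha> (Suc (Suc n))) > 0 \<and>
    degree (cf_den \<alpha> (Suc n)) = (\<Sum>i=2..Suc n. degree (partial_quotient \<alpha> i)) \<and>
    fls_subdegree (cf_err \<alpha> n) = int (degree (cf_den \<alpha> (Suc n)))"
proof -
  \<comment> \<open>A nonzero error makes the fractional part of the tail nonzero. That part has
    subdegree at least 1, and its inverse, the next tail, has a polynomial part of exactly that
    degree.\<close>
  have frac: "cf_tail \<alpha> n \<noteq> of_pol (partial_quotient \<alpha> (Suc n)) \<and>
      degree (partial_quotient \<alpha> (Suc (Suc n))) > 0 \<and>
      fls_subdegree (of_pol (partial_quotient \<alpha> (Suc n)) - cf_tail \<alpha> n)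
        = int (degree (partial_quotient \<alpha> (Suc (Suc n))))"
    if "cf_den \<alpha> (Suc n) \<noteq> 0"
      "cf_err \<alpha> (Suc n) = (of_pol (partial_quotient \<alpha> (Suc n)) - cf_tail \<alpha> n) * cf_err \<alpha> n" for n
  proof -
    define f where "f = cf_tail \<alpha> n - of_pol (pol_part (cf_tail \<alpha> n))"
    from that irr have "cf_err \<alpha> (Suc n) \<noteq> 0"
      unfolding cf_err_def by (intro irrational_linear_nonzero)
    with that have ne: "cf_tail \<alpha> n \<noteq> of_pol (partial_quotient \<alpha> (Suc n))" by auto
    then have f0: "f \<noteq> 0" by (simp add: f_def partial_quotient_def)
    have f1: "fls_subdegree f \<ge> 1"
      unfolding f_def using f0 by (intro fls_subdegree_frac_part) (simp add: f_def)
    have tail: "fls_subdegree (cf_tail \<alpha> (Suc n)) = - fls_subdegree f"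
      using f0 by (simp flip: f_def add: fls_divide_subdegree)
    have "degree (partial_quotient \<alpha> (Suc (Suc n))) = nat (fls_subdegree f)"
      using tail f1 unfolding partial_quotient_def by (subst degree_pol_part) simp_all
    moreover have "fls_subdegree (of_pol (partial_quotient \<alpha> (Suc n)) - cf_tail \<alpha> n) = fls_subdegree f"
      by (simp add: f_def partial_quotient_def fls_subdegree_minus_sym)
    ultimately show ?thesis using ne f1 by simp
  qed
  show ?thesis
  proof (induction n)
    case 0
    have e: "cf_err \<alpha> (Suc 0) = (of_pol (partial_quotient \<alpha> (Suc 0)) - cf_tail \<alpha> 0) * cf_err \<alpha> 0"
      by (simp add: cf_err_def)
    from frac[of 0] e show ?case by (simp add: cf_err_def)
  next
    case (Suc n)
    define f where "f = of_pol (partial_quotient \<alpha> (Suc n)) - cf_tail \<alpha> n"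
    define a where "a = partial_quotient \<alpha> (Suc (Suc n))"
    have fr: "f \<noteq> 0" "fls_subdegree f = int (degree a)" "degree a > 0"
      using frac[of n] Suc by (auto simp: f_def a_def)
    have e1: "cf_err \<alpha> (Suc n) = f * cf_err \<alpha> n" using Suc by (simp add: f_def)
    with fr Suc have ne: "cf_err \<alpha> (Suc n) \<noteq> 0" by simp
    have tl: "cf_tail \<alpha> (Suc n) = - 1 / f"
      using fr by (simp add: f_def partial_quotient_def field_simps)
    have "cf_err \<alpha> (Suc (Suc n)) = of_pol a * cf_err \<alpha> (Suc n) + cf_err \<alpha> n"
      by (simp add: cf_err_def a_def of_pol_add of_pol_mult algebra_simps)
    \<comment> \<open>The next tail is -1/f, so \<open>cf_err \<alpha> n\<close> is a multiple of
      the next error. This turns the three-term recurrence into a product.\<close>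
    also have "cf_err \<alpha> n = - cf_tail \<alpha> (Suc n) * cf_err \<alpha> (Suc n)"
      using fr unfolding e1 tl by simp
    finally have e2: "cf_err \<alpha> (Suc (Suc n)) = (of_pol a - cf_tail \<alpha> (Suc n)) * cf_err \<alpha> (Suc n)"
      by (simp add: algebra_simps)
    have dm: "degree (a * cf_den \<alpha> (Suc n)) = degree a + degree (cf_den \<alpha> (Suc n))"
      using fr Suc by (intro degree_mult_eq) auto
    \<comment> \<open>Since \<open>a\<close> is non-constant and denominator degrees do not
      decrease, the product alone determines the leading term.\<close>
    have dd: "degree (cf_den \<alpha> (Suc (Suc n))) = degree a + degree (cf_den \<alpha> (Suc n))"
      using fr Suc by (simp flip: a_def) (subst degree_add_eq_left, simp_all add: dm)
    with fr have nz: "cf_den \<alpha> (Suc (Suc n)) \<noteq> 0" by auto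
    have sd: "fls_subdegree (cf_err \<alpha> (Suc n)) = int (degree (cf_den \<alpha> (Suc (Suc n))))"
    proof -
      have "fls_subdegree (f * cf_err \<alpha> n) = fls_subdegree f + fls_subdegree (cf_err \<alpha> n)"
        using fr Suc by (intro fls_subdegree_mult) auto
      with fr Suc show ?thesis unfolding e1 dd by linarith
    qed
    have "degree (cf_den \<alpha> (Suc (Suc n))) = (\<Sum>i=2..Suc (Suc n). degree (partial_quotient \<alpha> i))"
      using Suc by (simp only: dd) (simp add: a_def)
    with ne e2 nz dd sd frac[of "Suc n"] show ?case by (simp add: a_def)
  qed
qed

lemma
  assumes "irrational \<alpha>"
  shows cf_den_nonzero: "n > 0 \<Longrightarrow> cf_den \<alpha> n \<noteq> 0"
    and degree_partial_quotient_pos: "n \<ge> 2 \<Longrightarrow> degree (partial_quotient \<alpha> n) > 0"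
    and degree_cf_den: "n > 0 \<Longrightarrow> degree (cf_den \<alpha> n) = (\<Sum>i=2..n. degree (partial_quotient \<alpha> i))"
    and fls_subdegree_cf_err: "fls_subdegree (cf_err \<alpha> n) = int (degree (cf_den \<alpha> (Suc n)))"
    and cf_err_nonzero: "cf_err \<alpha> n \<noteq> 0"
proof -
  note aux = convergent_invariants[OF assms]
  show "cf_den \<alpha> n \<noteq> 0" "degree (cf_den \<alpha> n) = (\<Sum>i=2..n. degree (partial_quotient \<alpha> i))" if "n > 0"
    using aux[of "n - 1"] that by simp_all
  show "degree (partial_quotient \<alpha> n) > 0" if "n \<ge> 2"
    using aux[of "n - 2"] that by (simp add: numeral_2_eq_2 Suc_diff_Suc)
  show "fls_subdegree (cf_err \<alpha> n) = int (degree (cf_den \<alpha> (Suc n)))" "cf_err \<alpha> n \<noteq> 0"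
    using aux[of n] by simp_all
qed

lemma degree_cf_den_Suc:
  assumes "irrational \<alpha>" "n > 0"
  shows "degree (cf_den \<alpha> (Suc n)) = degree (cf_den \<alpha> n) + degree (partial_quotient \<alpha> (Suc n))"
  using assms by (simp add: degree_cf_den)

section \<open>The irrationality measure in terms of the partial quotients\<close>

text \<open>Both logarithms are integer multiples of ln t, which cancels, so the exponent is a
  quotient of degrees. For constant Q both sides are 0 by division by zero.\<close>

lemma approximation_exponent:
  assumes "t > 1" "irrational \<alpha>" "Q \<noteq> 0"
  shows "- ln (absv t (\<alpha> - of_pol P / of_pol Q)) / ln (absv t (of_pol Q)) =
    real_of_int (fls_subdegree (of_pol Q * \<alpha> - of_pol P) + int (degree Q)) / real (degree Q)"
proof -
  define d where "d = of_pol Q * \<alpha> - of_pol P"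
  have d: "d \<noteq> 0" using assms unfolding d_def by (intro irrational_linear_nonzero)
  have eq: "\<alpha> - of_pol P / of_pol Q = d / of_pol Q"
    using assms by (simp add: d_def field_simps)
  have "fls_subdegree (d / of_pol Q) = fls_subdegree d + int (degree Q)"
    using d assms by (simp add: fls_divide_subdegree fls_subdegree_of_pol)
  then show ?thesis
    using assms d unfolding eq d_def[symmetric]
    by (simp add: ln_absv fls_subdegree_of_pol add_divide_distrib diff_divide_distrib)
qed

text \<open>The error q_n \<alpha> - p_n has subdegree deg q_(n+1) = deg q_n + deg a_(n+1). The
  bound n \<ge> 2 makes deg q_n positive.\<close>

lemma convergent_exponent:
  assumes "t > 1" "irrational \<alpha>" "n \<ge> 2"
  shows "- ln (absv t (\<alpha> - of_pol (cf_num \<alpha> n) / of_pol (cf_den \<alpha> n))) / ln (absv t (of_pol (cf_den \<alpha> n)))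
    = 2 + real (degree (partial_quotient \<alpha> (Suc n))) / real (degree (cf_den \<alpha> n))"
proof -
  have pos: "degree (cf_den \<alpha> n) > 0"
    using assms degree_partial_quotient_pos[of \<alpha> 2]
    by (simp add: degree_cf_den sum_pos2[of _ 2])
  have "fls_subdegree (of_pol (cf_den \<alpha> n) * \<alpha> - of_pol (cf_num \<alpha> n))
      = int (degree (cf_den \<alpha> n) + degree (partial_quotient \<alpha> (Suc n)))"
    using assms fls_subdegree_cf_err[of \<alpha> n] by (simp add: cf_err_def degree_cf_den_Suc)
  then show ?thesis
    using pos assms
    by (subst approximation_exponent) (simp_all add: cf_den_nonzero add_divide_distrib)
qed

text \<open>
  If \<open>w = 0\<close> then \<open>P/Q = p\<^sub>n/q\<^sub>n\<close>; otherwise \<open>w\<close> has absolute value at least 1 and dominates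
  \<open>Q (q\<^sub>n \<alpha> - p\<^sub>n)\<close>.
\<close>

lemma approximation_exponent_le:
  assumes "t > 1" "irrational \<alpha>" "n \<ge> 2" "degree (cf_den \<alpha> n) \<le> degree Q"
    "degree Q < degree (cf_den \<alpha> (Suc n))"
  shows "- ln (absv t (\<alpha> - of_pol P / of_pol Q)) / ln (absv t (of_pol Q))
    \<le> 2 + real (degree (partial_quotient \<alpha> (Suc n))) / real (degree (cf_den \<alpha> n))"
proof -
  define q where "q = cf_den \<alpha> n"
  define d where "d = of_pol Q * \<alpha> - of_pol P"
  define w where "w = Q * cf_num \<alpha> n - P * q"
  have pos: "degree q > 0"
    using assms degree_partial_quotient_pos[of \<alpha> 2]
    by (simp add: q_def degree_cf_den sum_pos2[of _ 2])
  then have q0: "q \<noteq> 0" and Q0: "Q \<noteq> 0" and Qpos: "degree Q > 0" using assms by (auto simp: q_def)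
  have d0: "d \<noteq> 0" using assms Q0 unfolding d_def by (intro irrational_linear_nonzero)
  have qd: "of_pol q * d = of_pol Q * cf_err \<alpha> n + of_pol w"
    by (simp add: d_def w_def q_def cf_err_def of_pol_diff of_pol_mult algebra_simps)
  have sqd: "fls_subdegree (of_pol q * d) = fls_subdegree d - int (degree q)"
    using q0 d0 by (simp add: fls_subdegree_of_pol)
  have err0: "of_pol Q * cf_err \<alpha> n \<noteq> 0" using assms Q0 by (simp add: cf_err_nonzero)
  have serr: "fls_subdegree (of_pol Q * cf_err \<alpha> n) = int (degree (cf_den \<alpha> (Suc n))) - int (degree Q)"
    using assms Q0 by (simp add: cf_err_nonzero fls_subdegree_cf_err fls_subdegree_of_pol)
  have "real_of_int (fls_subdegree d + int (degree Q)) / real (degree Q)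
      \<le> 2 + real (degree (partial_quotient \<alpha> (Suc n))) / real (degree q)"
  proof (cases "w = 0")
    case True
    then have "fls_subdegree d + int (degree Q) = int (degree q) + int (degree (cf_den \<alpha> (Suc n)))"
      using sqd serr qd by simp
    also have "\<dots> = int (2 * degree q + degree (partial_quotient \<alpha> (Suc n)))"
      using assms by (simp add: q_def degree_cf_den_Suc)
    finally have "real_of_int (fls_subdegree d + int (degree Q)) / real (degree Q)
      = real (2 * degree q + degree (partial_quotient \<alpha> (Suc n))) / real (degree Q)" by simp
    \<comment> \<open>\<open>P/Q\<close> is the convergent, possibly not in lowest terms: the
      approximation error is unchanged while the degree of the denominator can only be
      larger.\<close>
    also have "\<dots> \<le> real (2 * degree q + degree (partial_quotient \<alpha> (Suc n))) / real (degree q)"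
      using pos assms by (intro divide_left_mono) (auto simp: q_def)
    finally show ?thesis using pos by (simp add: add_divide_distrib)
  next
    case False
    have "fls_subdegree (of_pol q * d) = - int (degree w)"
      unfolding qd using False assms serr
      by (subst fls_subdegree_add_eq2) (simp_all add: fls_subdegree_of_pol)
    with sqd assms have "fls_subdegree d \<le> int (degree Q)" by (simp add: q_def)
    then have "real_of_int (fls_subdegree d + int (degree Q)) \<le> 2 * real (degree Q)"
      by simp
    then have "real_of_int (fls_subdegree d + int (degree Q)) / real (degree Q) \<le> 2"
      using Qpos by (simp add: field_simps)
    then show ?thesis by (rule order_trans) simp
  qed
  then show ?thesis
    using approximation_exponent[OF assms(1,2) Q0] by (simp add: d_def q_def)
qed

text \<open>Composing with a map that tends to F samples only part of what F sees. This serves the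
  convergents among all fractions, and later the passages between block numbers and positions in the
  word.\<close>

lemma Limsup_filterlim_le:
  fixes f :: "'b \<Rightarrow> 'c::complete_lattice"
  assumes "filterlim g F G"
  shows "Limsup G (\<lambda>x. f (g x)) \<le> Limsup F f"
proof -
  have "Limsup G (\<lambda>x. f (g x)) \<le> Limsup (filtermap g G) f"
    by (rule Limsup_filtermap_ge)
  also have "\<dots> \<le> Limsup F f"
    unfolding Limsup_def using assms
    by (intro INF_superset_mono) (auto simp: filterlim_def le_filter_def)
  finally show ?thesis .
qed

theorem irrationality_measure_partial_quotients:
  assumes t: "t > 1" and irr: "irrational \<alpha>"
  shows "irrationality_measure t \<alpha> =
    limsup (\<lambda>n. ereal (2 + real (degree (partial_quotient \<alpha> (Suc n)))
      / real (\<Sum>i=2..n. degree (partial_quotient \<alpha> i))))"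
    (is "_ = limsup ?r")
proof -
  define F where "F = filtercomap (\<lambda>(P::'a poly, Q::'a poly). absv t (of_pol Q)) at_top"
  define X where "X = (\<lambda>(P, Q). ereal (- ln (absv t (\<alpha> - of_pol P / of_pol Q)) / ln (absv t (of_pol Q))))"
  have measure: "irrationality_measure t \<alpha> = Limsup F X"
    by (simp add: irrationality_measure_def F_def X_def)
  have rr: "?r n = ereal (2 + real (degree (partial_quotient \<alpha> (Suc n))) / real (degree (cf_den \<alpha> n)))"
    if "n > 0" for n
    using that irr by (simp add: degree_cf_den)
  have absQ: "absv t (of_pol Q) = t ^ degree Q" if "Q \<noteq> 0" for Q :: "'a poly"
    using that by (simp add: absv_def fls_subdegree_of_pol)
  define D where "D = (\<lambda>n. degree (cf_den \<alpha> n))"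
  have D_mono: "D n < D (Suc n)" if "n > 0" for n
    using that irr degree_partial_quotient_pos[of \<alpha> "Suc n"] by (simp add: D_def degree_cf_den_Suc)
  \<comment> \<open>Degrees of denominators start from deg q_1 = 0 and then rise by at least 1. This
    linear bound drives the convergents to infinity and bounds the set whose greatest element is
    taken below.\<close>
  have D_ge: "n \<le> Suc (D n)" for n
  proof (induction n)
    case (Suc n)
    then show ?case using D_mono[of n] by (cases "n = 0") auto
  qed simp
  have D_le: "D m \<le> D n" if "m \<le> n" for m n
    using that
  proof (induction n rule: dec_induct)
    case (step n)
    then show ?case using D_mono[of n] by (cases "n = 0") (auto simp: D_def)
  qed simp
  have "limsup ?r = limsup (\<lambda>n. X (cf_num \<alpha> n, cf_den \<alpha> n))"
  proof (intro Limsup_eq eventually_sequentiallyI[of 2])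
    fix n :: nat assume n: "n \<ge> 2"
    then have "?r n = ereal (2 + real (degree (partial_quotient \<alpha> (Suc n))) / real (degree (cf_den \<alpha> n)))"
      by (intro rr) simp
    also have "\<dots> = X (cf_num \<alpha> n, cf_den \<alpha> n)"
      using convergent_exponent[OF t irr n] by (simp add: X_def)
    finally show "?r n = X (cf_num \<alpha> n, cf_den \<alpha> n)" .
  qed
  also have "\<dots> \<le> Limsup F X"
  proof (rule Limsup_filterlim_le)
    have "filterlim (\<lambda>n. absv t (of_pol (cf_den \<alpha> n))) at_top sequentially"
    proof (rule filterlim_at_top_mono)
      have "filterlim (\<lambda>n. t ^ n) at_top sequentially"
        using t by (intro filterlim_at_infinity_imp_filterlim_at_top filterlim_realpow_sequentially_gt1) auto
      moreover have "filterlim (\<lambda>n::nat. n - 1) at_top sequentially"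
        by (rule filterlim_minus_const_nat_at_top)
      ultimately show "filterlim (\<lambda>n. t ^ (n - 1)) at_top sequentially"
        by (rule filterlim_compose)
      show "\<forall>\<^sub>F n in sequentially. t ^ (n - 1) \<le> absv t (of_pol (cf_den \<alpha> n))"
        using t irr D_ge
        by (intro eventually_sequentiallyI[of 1])
          (simp add: absQ cf_den_nonzero power_increasing D_def diff_le_eq le_diff_conv)
    qed
    then show "filterlim (\<lambda>n. (cf_num \<alpha> n, cf_den \<alpha> n)) F sequentially"
      by (simp add: F_def filterlim_filtercomap_iff o_def)
  qed
  finally have ge: "limsup ?r \<le> Limsup F X" .
  have le: "Limsup F X \<le> limsup ?r"
    unfolding Limsup_le_iff
  proof (intro allI impI)
    fix y assume "y > limsup ?r"
    then have "eventually (\<lambda>n. ?r n < y) sequentially" using Limsup_lessD by blast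
    then obtain N0 where N0: "\<And>n. n \<ge> N0 \<Longrightarrow> ?r n < y" by (auto simp: eventually_sequentially)
    \<comment> \<open>The 2 is the least index at which \<open>approximation_exponent_le\<close>
      applies.\<close>
    define N where "N = max 2 N0"
    have "X (P, Q) < y" if big: "absv t (of_pol Q) \<ge> t ^ D N" for P Q
    proof -
      have "t ^ D N > 0" using t by simp
      with big have Q0: "Q \<noteq> 0" by (auto simp: absv_def)
      with big t have dQ: "D N \<le> degree Q" by (simp add: absQ power_le_imp_le_exp)
      \<comment> \<open>The index with deg q_n \<le> deg Q < deg q_(n+1). The threshold on the
        absolute value of Q forces it to be at least \<open>N\<close>.\<close>
      define n where "n = (GREATEST n. D n \<le> degree Q)"
      have bnd: "n \<le> Suc (degree Q)" if "D n \<le> degree Q" for n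
        using that D_ge[of n] by linarith
      have n1: "D n \<le> degree Q"
        unfolding n_def by (rule GreatestI_nat[of "\<lambda>n. D n \<le> degree Q", OF dQ bnd])
      have n2: "N \<le> n"
        unfolding n_def by (rule Greatest_le_nat[of "\<lambda>n. D n \<le> degree Q", OF dQ bnd])
      have n3: "degree Q < D (Suc n)"
      proof (rule ccontr)
        assume "\<not> degree Q < D (Suc n)"
        then have "Suc n \<le> n"
          unfolding n_def by (intro Greatest_le_nat[of "\<lambda>n. D n \<le> degree Q", OF _ bnd]) auto
        then show False by simp
      qed
      have "X (P, Q) \<le> ereal (2 + real (degree (partial_quotient \<alpha> (Suc n))) / real (degree (cf_den \<alpha> n)))"
        using approximation_exponent_le[OF t irr, of n Q P] n1 n2 n3
        by (simp add: X_def D_def N_def)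
      also have "\<dots> = ?r n"
        by (rule rr[symmetric]) (use n2 in \<open>simp add: N_def\<close>)
      also have "?r n < y" using n2 by (intro N0) (simp add: N_def)
      finally show ?thesis .
    qed
    then show "eventually (\<lambda>x. y > X x) F"
      unfolding F_def eventually_filtercomap_at_top_linorder by (intro exI[of _ "t ^ D N"]) auto
  qed
  from ge le measure show ?thesis by simp
qed

section \<open>Degrees of the partial quotients\<close>

lemma degree_Ppol: "degree (Ppol k :: 'a::field poly) = 2 * k"
proof -
  have "degree (monom 1 2 - 1 :: 'a poly) = 2"
    using degree_add_eq_left[of "- 1" "monom 1 2 :: 'a poly"] by (simp add: degree_monom_eq)
  moreover from this have "monom 1 2 - 1 \<noteq> (0 :: 'a poly)" by auto
  ultimately show ?thesis by (simp add: Ppol_def degree_power_eq)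
qed

lemma Ppol_nonzero: "(Ppol k :: 'a::field poly) \<noteq> 0"
proof -
  have "coeff (monom 1 2 - 1 :: 'a poly) 2 = 1" by simp
  then have "(monom 1 2 - 1 :: 'a poly) \<noteq> 0" by (metis coeff_0 zero_neq_one)
  then show ?thesis by (simp add: Ppol_def)
qed

text \<open>The remainder has degree below that of y, hence below that of
  \<open>x div y * y\<close>, so it cannot affect the leading term.\<close>

lemma degree_div_eq:
  fixes x y :: "'a::field poly"
  assumes "y \<noteq> 0" "degree y \<le> degree x" "x \<noteq> 0"
  shows "degree (x div y) = degree x - degree y"
proof -
  have ne: "x div y \<noteq> 0"
  proof
    assume "x div y = 0"
    then have "x mod y = x" using div_mult_mod_eq[of x y] by simp
    with assms degree_mod_less'[of y x] show False by simp
  qed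
  have dm: "degree (x div y * y) = degree (x div y) + degree y"
    using ne assms by (simp add: degree_mult_eq)
  have "degree (x div y * y + x mod y) = degree (x div y * y)"
  proof (cases "x mod y = 0")
    case False
    with assms have "degree (x mod y) < degree y" by (rule_tac degree_mod_less')
    then show ?thesis by (intro degree_add_eq_left) (simp add: dm)
  qed simp
  then show ?thesis by (simp add: dm)
qed

text \<open>Solves d_(n+1) = p d_n - 2k (-1)^n with d_0 = 1, the recurrence for the degrees of the
  B_n. Real values allow the limits taken later.\<close>

definition weight :: "nat \<Rightarrow> nat \<Rightarrow> nat \<Rightarrow> real" where
  "weight p k n = ((real p + 1 - 2 * real k) * real p ^ n + 2 * real k * (- 1) ^ n) / (real p + 1)"

lemma weight_0 [simp]: "weight p k 0 = 1"
  by (simp add: weight_def field_simps)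

lemma weight_Suc: "weight p k (Suc n) = real p * weight p k n - 2 * real k * (- 1) ^ n"
proof -
  have "real p + 1 \<noteq> 0" by linarith
  then show ?thesis by (simp add: weight_def field_simps)
qed

lemma weight_even: "weight p k (2 * n) =
    ((real p + 1 - 2 * real k) * (real p)\<^sup>2 ^ n + 2 * real k) / (real p + 1)"
  by (simp add: weight_def power_mult)

lemma weight_odd: "weight p k (2 * n + 1) =
    ((real p + 1 - 2 * real k) * real p * (real p)\<^sup>2 ^ n - 2 * real k) / (real p + 1)"
  by (simp add: weight_def power_mult)

text \<open>Once the weight is at least 1, multiplying by p adds at least p - 1 \<ge> 2k, which
  outweighs the correction of size 2k. So the lower bound propagates and monotonicity comes with
  it.\<close>

lemma weight_step:
  assumes "2 * k < p"
  shows "weight p k n \<ge> 1 \<and> weight p k n \<le> weight p k (Suc n)"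
proof -
  have step: "weight p k n \<le> weight p k (Suc n)" if "weight p k n \<ge> 1" for n
  proof -
    have "2 * real k \<le> real p - 1" using assms by linarith
    also have "\<dots> * 1 \<le> (real p - 1) * weight p k n"
      using that assms by (intro mult_left_mono) auto
    finally have "2 * real k \<le> real p * weight p k n - weight p k n" by (simp add: algebra_simps)
    moreover have "2 * real k * (- 1) ^ n \<le> 2 * real k" by (cases "even n") auto
    ultimately show ?thesis unfolding weight_Suc by linarith
  qed
  have "weight p k n \<ge> 1" for n
    by (induction n) (use step order_trans in \<open>auto simp del: One_nat_def\<close>)
  with step show ?thesis by blast
qed

lemma weight_ge_1: "2 * k < p \<Longrightarrow> weight p k n \<ge> 1"
  by (simp add: weight_step)

lemma weight_mono: "2 * k < p \<Longrightarrow> m \<le> n \<Longrightarrow> weight p k m \<le> weight p k n"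
  using lift_Suc_mono_le[of "weight p k"] weight_step by blast

lemma degree_Bpol:
  assumes "2 * k < CARD('p)"
  shows "real (degree (Bpol k n :: 'p::prime_card mod_ring poly)) = weight CARD('p) k n"
proof (induction n rule: induct_nat_012)
  case 0
  then show ?case by (simp add: degree_monom_eq)
next
  case 1
  have "fls_subdegree (of_pol (monom 1 CARD('p)) / of_pol (Ppol k) :: 'p mod_ring fls)
      = 2 * int k - int CARD('p)"
    by (subst fls_divide_subdegree)
      (simp_all add: Ppol_nonzero fls_subdegree_of_pol degree_Ppol degree_monom_eq)
  then show ?case
    using assms by (simp add: degree_pol_part weight_Suc)
next
  case (ge2 n)
  define B where "B = (Bpol k (Suc n) :: 'p mod_ring poly)"
  have IH: "real (degree B) = weight CARD('p) k (Suc n)" using ge2 by (simp add: B_def)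
  then have "degree B \<ge> 1" using weight_ge_1[OF assms, of "Suc n"] by simp
  then have B0: "B \<noteq> 0" by auto
  have dp: "degree (B ^ CARD('p)) = CARD('p) * degree B" by (simp add: degree_power_eq B0)
  \<comment> \<open>Keeps the subtraction of natural numbers from truncating when
    \<open>Ppol k\<close> is divided out.\<close>
  have "2 * k \<le> CARD('p) * degree B"
    using assms \<open>degree B \<ge> 1\<close> by (metis le_trans less_imp_le mult.right_neutral mult_le_mono2)
  then show ?case
    using B0 unfolding weight_Suc[of _ _ "Suc n"] IH[symmetric]
    by (cases "odd (Suc n)")
      (simp_all flip: B_def add: degree_mult_eq degree_div_eq Ppol_nonzero degree_Ppol dp of_nat_diff)
qed

section \<open>Streams of concatenated blocks\<close>

lemma flat_smap_nats:
  assumes "\<And>n. f n \<noteq> []"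
  shows "flat (smap f nats) = concat (map f [0..<n]) @- flat (smap f (fromN n))"
proof (induction n)
  case (Suc n)
  have "flat (smap f (fromN n)) = f n @- flat (smap f (fromN (Suc n)))"
    using flat_unfold[of "smap f (fromN n)"] assms by simp
  with Suc show ?case by simp
qed simp

lemma
  assumes "\<And>n. f n \<noteq> []" "i < length (f n)"
  shows snth_flat_block: "flat (smap f nats) !! (length (concat (map f [0..<n])) + i) = f n ! i"
    and stake_flat_block: "stake (length (concat (map f [0..<n])) + i) (flat (smap f nats))
      = concat (map f [0..<n]) @ take i (f n)"
proof -
  have "flat (smap f nats) = concat (map f [0..<n]) @- f n @- flat (smap f (fromN (Suc n)))"
    using flat_smap_nats[of f n, OF assms(1)] flat_unfold[of "smap f (fromN n)"] assms by simp
  then show "flat (smap f nats) !! (length (concat (map f [0..<n])) + i) = f n ! i"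
    and "stake (length (concat (map f [0..<n])) + i) (flat (smap f nats))
      = concat (map f [0..<n]) @ take i (f n)"
    using assms(2) by (simp_all add: stake_shift)
qed

text \<open>Moving one position on either stays in the same block or, blocks being nonempty, lands
  at offset 0 of the next.\<close>

lemma block_position:
  fixes f :: "nat \<Rightarrow> 'a list"
  assumes "\<And>n. f n \<noteq> []"
  shows "\<exists>n i. j = length (concat (map f [0..<n])) + i \<and> i < length (f n)"
proof (induction j)
  case 0
  then show ?case using assms by (intro exI[of _ 0]) simp
next
  case (Suc j)
  then obtain n i where j: "j = length (concat (map f [0..<n])) + i" and i: "i < length (f n)"
    by blast
  show ?case
  proof (cases "Suc i < length (f n)")
    case True
    with j show ?thesis by (intro exI[of _ n] exI[of _ "Suc i"]) simp
  next
    case False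
    with i have "Suc i = length (f n)" by simp
    with j assms show ?thesis by (intro exI[of _ "Suc n"] exI[of _ 0]) simp
  qed
qed

lemma sum_list_stake:
  fixes g :: "'a \<Rightarrow> 'b::comm_monoid_add"
  shows "sum_list (map g (stake n s)) = (\<Sum>i<n. g (s !! i))"
  by (induction n) (simp_all add: stake_Suc add.commute del: stake.simps(2))

section \<open>Weights of the blocks\<close>

lemma set_wpow: "set (wpow w n) \<subseteq> set w"
  by (auto simp: wpow_def)

lemma sum_list_wpow: "sum_list (map g (wpow w n)) = real n * sum_list (map g w)"
  by (induction n) (simp_all add: wpow_def algebra_simps)

lemma set_Jword: "set (Jword k n) \<subseteq> {..<2 * n}"
proof (induction k n rule: Jword.induct)
  case (2 k)
  then show ?case using set_wpow[of "[0]" "2 * k"] by auto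
next
  case (3 k n)
  then show ?case
    using set_wpow[of "Jword k (Suc n)" "2 * k - 1"]
      set_wpow[of "[2 * Suc n, 2 * Suc n - 1] @ wpow (Jword k (Suc n)) (2 * k - 1)" "2 * k - 1"]
    unfolding Jword.simps Let_def set_append by fastforce
qed simp

text \<open>The alternating terms cancel in a sum of neighbours. This fits the words, where 2n is
  always paired with 2n - 1 or 2n + 1.\<close>

lemma weight_add_Suc: "weight p k n + weight p k (Suc n) = (real p + 1 - 2 * real k) * real p ^ n"
proof -
  have "real p + 1 \<noteq> 0" by linarith
  then have "(real p + 1) * weight p k n = (real p + 1 - 2 * real k) * real p ^ n + 2 * real k * (- 1) ^ n"
    by (simp add: weight_def)
  then show ?thesis unfolding weight_Suc by (simp add: algebra_simps)
qed

text \<open>In the application \<open>total\<close> below is \<open>\<nu>\<^sub>1\<close>.\<close>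

locale block_word =
  fixes p k m :: nat and ls :: "nat \<Rightarrow> nat"
  assumes k_ge: "1 \<le> k" and kp: "2 * k < p" and m_ge: "1 \<le> m"
    and ls_ge: "\<And>i. 1 \<le> i \<Longrightarrow> i \<le> m \<Longrightarrow> 1 \<le> ls i"
begin

abbreviation W :: "nat list \<Rightarrow> real" where
  "W w \<equiv> sum_list (map (weight p k) w)"

lemma W_nonneg: "W w \<ge> 0"
proof (rule sum_list_nonneg)
  fix x assume "x \<in> set (map (weight p k) w)"
  then obtain n where "x = weight p k n" by auto
  with weight_ge_1[OF kp, of n] show "0 \<le> x" by simp
qed

text \<open>With N the index of the inner word, a repeated unit weighs (p+1-2k) p^(2N-1) + (2k-1)
  p^(2N-1) = p^(2N). Then 2k - 1 units and the final pair (p+1-2k) p^(2N) add up to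
  p^(2N+1).\<close>

lemma W_Jword: "W (Jword k (Suc n)) = real p ^ (2 * n + 1)"
proof (induction n)
  case 0
  then show ?case by (simp add: sum_list_wpow weight_Suc)
next
  case (Suc n)
  define N where "N = Suc n"
  have pair: "weight p k (2 * N) + weight p k (2 * N - 1) = (real p + 1 - 2 * real k) * real p ^ (2 * n + 1)"
    using weight_add_Suc[of p k "2 * n + 1"] by (simp add: N_def add.commute)
  have pair': "weight p k (2 * N) + weight p k (2 * N + 1) = (real p + 1 - 2 * real k) * real p ^ (2 * N)"
    using weight_add_Suc[of p k "2 * N"] by simp
  have k': "real (2 * k - 1) = 2 * real k - 1" using k_ge by (simp add: of_nat_diff)
  have "W (Jword k (Suc N)) = real (2 * k - 1) *
      ((weight p k (2 * N) + weight p k (2 * N - 1)) + real (2 * k - 1) * W (Jword k N))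
      + (weight p k (2 * N) + weight p k (2 * N + 1))"
    by (simp add: N_def Let_def sum_list_wpow)
  also have "\<dots> = (2 * real k - 1) * (real p * real p ^ (2 * n + 1)) + (real p + 1 - 2 * real k) * real p ^ (2 * N)"
    unfolding pair pair' k' using Suc by (simp add: N_def algebra_simps)
  also have "\<dots> = real p ^ (2 * N + 1)" by (simp add: N_def algebra_simps)
  finally show ?case by (simp add: N_def)
qed

text \<open>V_(n,i) is cut before its last letter, so that for i = 1 this is exactly the part of V_n
  preceding the first letter 2n + 1.\<close>

definition head_block :: "nat \<Rightarrow> nat \<Rightarrow> nat list" where
  "head_block n i = wpow ([2 * n, 2 * n - 1] @ wpow (Jword k n) (2 * k - 1)) (ls i - 1) @ [2 * n]"

lemma Vblock_eq: "Vblock k ls n i = head_block n i @ [2 * n + 1]"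
  by (simp add: Vblock_def head_block_def)

text \<open>If l_i = 1 the repetition is empty and the letter 2n comes from the end of the
  definition instead.\<close>

lemma head_block_0: "head_block n i ! 0 = 2 * n"
  by (cases "ls i - 1") (simp_all add: head_block_def wpow_def)

lemma set_head_block: "set (head_block n i) \<subseteq> {..2 * n}"
proof -
  have "set (wpow (Jword k n) (2 * k - 1)) \<subseteq> {..2 * n}"
    using set_wpow set_Jword by fastforce
  then have "set ([2 * n, 2 * n - 1] @ wpow (Jword k n) (2 * k - 1)) \<subseteq> {..2 * n}" by auto
  then show ?thesis
    unfolding head_block_def set_append using set_wpow by fastforce
qed

text \<open>Each repeated unit weighs p^(2n), by the same computation as for
  \<open>W_Jword\<close>.\<close>

lemma W_head_block:
  assumes "n \<ge> 1" "1 \<le> i" "i \<le> m"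
  shows "W (head_block n i) = (real (ls i) - 1) * (real p)\<^sup>2 ^ n + weight p k (2 * n)"
proof -
  obtain j where n: "n = Suc j" using assms by (cases n) auto
  have k': "real (2 * k - 1) = 2 * real k - 1" using k_ge by (simp add: of_nat_diff)
  have pw: "(real p)\<^sup>2 ^ n = real p * real p ^ (2 * j + 1)"
    by (simp add: n power_mult[symmetric]) (simp add: power2_eq_square)
  have "W (head_block n i) = real (ls i - 1) *
      ((weight p k (2 * n) + weight p k (2 * n - 1)) + real (2 * k - 1) * W (Jword k n)) + weight p k (2 * n)"
    by (simp add: head_block_def sum_list_wpow)
  also have "\<dots> = (real (ls i) - 1) *
      ((real p + 1 - 2 * real k) * real p ^ (2 * n - 1) + (2 * real k - 1) * real p ^ (2 * j + 1)) + weight p k (2 * n)"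
    using ls_ge[OF assms(2,3)] W_Jword[of j] weight_add_Suc[of p k "2 * j + 1"] k'
    by (simp add: n of_nat_diff add.commute)
  also have "(real p + 1 - 2 * real k) * real p ^ (2 * n - 1) + (2 * real k - 1) * real p ^ (2 * j + 1)
      = (real p)\<^sup>2 ^ n"
    unfolding pw by (simp add: n algebra_simps)
  finally show ?thesis .
qed

lemma W_Vblock:
  assumes "n \<ge> 1" "1 \<le> i" "i \<le> m"
  shows "W (Vblock k ls n i) = (real (ls i) + real p - 2 * real k) * (real p)\<^sup>2 ^ n"
proof -
  have "real p ^ (2 * n) = (real p)\<^sup>2 ^ n" by (simp add: power_mult)
  with W_head_block[OF assms] weight_add_Suc[of p k "2 * n"] show ?thesis
    by (simp add: Vblock_eq algebra_simps)
qed

definition total :: real where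
  "total = (\<Sum>i=1..m. real (ls i) + real p - 2 * real k)"

lemma sum_list_upt: "(\<Sum>i\<leftarrow>[1..<Suc m]. f i) = (\<Sum>i=1..m. f i)" for f :: "nat \<Rightarrow> real"
  by (subst interv_sum_list_conv_sum_set_nat) (simp add: atLeastLessThanSuc_atLeastAtMost del: upt_Suc)

lemma W_concat: "W (concat ws) = sum_list (map W ws)"
  by (induction ws) simp_all

lemma W_Vword: "W (Vword k m ls n) = total * (real p)\<^sup>2 ^ n"
proof (cases "n = 0")
  case True
  then have "W (Vword k m ls n) = (\<Sum>i\<leftarrow>[1..<Suc m]. real (ls i) + real p - 2 * real k)"
    by (simp add: Vword_def W_concat o_def sum_list_wpow weight_Suc algebra_simps del: upt_Suc)
  with True show ?thesis by (simp add: total_def sum_list_upt del: upt_Suc One_nat_def)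
next
  case False
  then have "W (Vword k m ls n) = (\<Sum>i\<leftarrow>[1..<Suc m]. W (Vblock k ls n i))"
    by (simp add: Vword_def W_concat o_def del: upt_Suc)
  also have "\<dots> = (\<Sum>i=1..m. (real (ls i) + real p - 2 * real k) * (real p)\<^sup>2 ^ n)"
    unfolding sum_list_upt using False by (intro sum.cong) (auto simp: W_Vblock)
  finally show ?thesis by (simp add: total_def sum_distrib_right)
qed

lemma Vword_split:
  assumes "n \<ge> 1"
  obtains rest where "Vword k m ls n = head_block n 1 @ (2 * n + 1) # rest" "set rest \<subseteq> {..2 * n + 1}"
proof
  have "[1..<Suc m] = 1 # [2..<Suc m]" using m_ge by (subst upt_conv_Cons) (simp_all add: numeral_2_eq_2)
  then show "Vword k m ls n = head_block n 1 @ (2 * n + 1) # concat (map (Vblock k ls n) [2..<Suc m])"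
    using assms by (simp add: Vword_def Vblock_eq del: upt_Suc)
  have "set (Vblock k ls n i) \<subseteq> {..2 * n + 1}" for i
    using set_head_block[of n i] by (auto simp: Vblock_eq)
  then show "set (concat (map (Vblock k ls n) [2..<Suc m])) \<subseteq> {..2 * n + 1}" by auto
qed

lemma Vword_0: obtains rest where "Vword k m ls 0 = 0 # rest"
proof -
  obtain j where j: "ls 1 = Suc j" using ls_ge[of 1] m_ge by (cases "ls 1") auto
  have "[1..<Suc m] = 1 # [2..<Suc m]" using m_ge by (subst upt_conv_Cons) (simp_all add: numeral_2_eq_2)
  then show ?thesis using that j by (simp add: Vword_def wpow_def del: upt_Suc)
qed

lemma Vword_nonempty: "Vword k m ls n \<noteq> []"
proof (cases "n = 0")
  case True
  obtain rest where "Vword k m ls 0 = 0 # rest" by (rule Vword_0)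
  with True show ?thesis by simp
next
  case False
  then obtain rest where "Vword k m ls n = head_block n 1 @ (2 * n + 1) # rest"
    using Vword_split[of n] by (metis One_nat_def Suc_leI not_gr_zero)
  then show ?thesis by simp
qed

text \<open>Each summand is at least 2, since l_i \<ge> 1 and p - 2k \<ge> 1. The strict bound keeps
  the denominators of the ratios positive after 1 is subtracted.\<close>

lemma total_gt_1: "total > 1"
proof -
  have "2 \<le> (\<Sum>i=1..m. 2::real)" using m_ge by simp
  also have "\<dots> \<le> total"
    unfolding total_def
  proof (rule sum_mono)
    fix i assume "i \<in> {1..m}"
    then have "1 \<le> ls i" using ls_ge[of i] by simp
    with kp show "2 \<le> real (ls i) + real p - 2 * real k" by linarith
  qed
  finally show ?thesis by simp
qed

section \<open>Ratios of a letter's weight to the weight before it\<close>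

definition prefix :: "nat \<Rightarrow> nat list" where
  "prefix n = concat (map (Vword k m ls) [0..<n])"

lemma p_gt_1: "real p > 1"
  using kp k_ge by linarith

lemma p_sq: "(real p)\<^sup>2 - 1 = (real p - 1) * (real p + 1)"
  by (simp add: power2_eq_square algebra_simps)

lemma p_sq_gt_1: "(real p)\<^sup>2 > 1"
  using p_gt_1 by (simp add: one_less_power)

lemma W_prefix: "W (prefix n) = total * ((real p)\<^sup>2 ^ n - 1) / ((real p)\<^sup>2 - 1)"
proof -
  have p1: "(real p)\<^sup>2 \<noteq> 1" using p_sq_gt_1 by simp
  have "W (prefix n) = (\<Sum>i<n. total * (real p)\<^sup>2 ^ i)"
    by (induction n) (simp_all add: prefix_def W_Vword)
  also have "\<dots> = total * (\<Sum>i<n. (real p)\<^sup>2 ^ i)" by (simp add: sum_distrib_left)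
  also have "(\<Sum>i<n. (real p)\<^sup>2 ^ i) = ((real p)\<^sup>2 ^ n - 1) / ((real p)\<^sup>2 - 1)"
    using p1 by (rule geometric_sum)
  finally show ?thesis by simp
qed

lemma W_prefix_gt_1:
  assumes "n \<ge> 1"
  shows "W (prefix n) > 1"
proof -
  have "prefix n = prefix 1 @ concat (map (Vword k m ls) [1..<n])"
    using assms by (simp add: prefix_def upt_conv_Cons)
  then have "W (prefix n) \<ge> W (prefix 1)" using W_nonneg by simp
  also have "W (prefix 1) = total" by (simp add: prefix_def W_Vword)
  finally show ?thesis using total_gt_1 by simp
qed

definition word :: "nat stream" where
  "word = flat (smap (Vword k m ls) nats)"

text \<open>The first letter is 0, of weight 1; subtracting it accounts for \<open>a\<^sub>1\<close> not contributing to \<open>deg q\<^sub>n\<close>.\<close>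

definition ratio :: "nat \<Rightarrow> real" where
  "ratio j = weight p k (word !! j) / (W (stake j word) - 1)"

definition ratio_even :: "nat \<Rightarrow> real" where
  "ratio_even n = weight p k (2 * n) / (W (prefix n) - 1)"

definition ratio_odd :: "nat \<Rightarrow> real" where
  "ratio_odd n = weight p k (2 * n + 1) / (W (prefix n) + W (head_block n 1) - 1)"

lemma
  assumes "i < length (Vword k m ls n)"
  shows snth_word: "word !! (length (prefix n) + i) = Vword k m ls n ! i"
    and stake_word: "stake (length (prefix n) + i) word = prefix n @ take i (Vword k m ls n)"
  using assms unfolding word_def prefix_def
  by (simp_all only: snth_flat_block stake_flat_block Vword_nonempty not_False_eq_True)

lemma ratio_even_eq:
  assumes "n \<ge> 1"
  shows "ratio (length (prefix n)) = ratio_even n"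
proof -
  obtain rest where V: "Vword k m ls n = head_block n 1 @ (2 * n + 1) # rest"
    using Vword_split[OF assms] .
  have "Vword k m ls n ! 0 = 2 * n"
    unfolding V by (subst nth_append) (simp add: head_block_0, simp add: head_block_def)
  then show ?thesis
    using snth_word[of 0 n] stake_word[of 0 n] Vword_nonempty[of n]
    by (simp add: ratio_def ratio_even_def)
qed

lemma ratio_odd_eq:
  assumes "n \<ge> 1"
  shows "ratio (length (prefix n) + length (head_block n 1)) = ratio_odd n"
proof -
  obtain rest where V: "Vword k m ls n = head_block n 1 @ (2 * n + 1) # rest"
    using Vword_split[OF assms] .
  then show ?thesis
    using snth_word[of "length (head_block n 1)" n] stake_word[of "length (head_block n 1)" n]
    by (simp add: ratio_def ratio_odd_def)
qed

text \<open>A letter up to 2n weighs at most what the first letter 2n of V_n does, and no less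
  weight precedes it. The only larger letter, 2n + 1, cannot occur before the end of the first head
  block, so \<open>ratio_odd\<close> bounds it in the same way.\<close>

lemma ratio_le:
  assumes "n \<ge> 1" "i < length (Vword k m ls n)"
  shows "ratio (length (prefix n) + i) \<le> max (ratio_even n) (ratio_odd n)"
proof -
  obtain rest where V: "Vword k m ls n = head_block n 1 @ (2 * n + 1) # rest"
    and rest: "set rest \<subseteq> {..2 * n + 1}"
    using Vword_split[OF assms(1)] .
  have eq: "ratio (length (prefix n) + i) =
      weight p k (Vword k m ls n ! i) / (W (prefix n) + W (take i (Vword k m ls n)) - 1)"
    using assms by (simp add: ratio_def snth_word stake_word)
  note pos = W_prefix_gt_1[OF assms(1)]
  show ?thesis
  proof (cases "Vword k m ls n ! i \<le> 2 * n")
    case True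
    have "ratio (length (prefix n) + i) \<le> ratio_even n"
      unfolding eq ratio_even_def
    proof (rule frac_le)
      show "weight p k (Vword k m ls n ! i) \<le> weight p k (2 * n)"
        using True kp by (intro weight_mono)
      show "W (prefix n) - 1 \<le> W (prefix n) + W (take i (Vword k m ls n)) - 1"
        using W_nonneg by simp
    qed (use pos weight_ge_1[OF kp, of "2 * n"] in simp_all)
    then show ?thesis by simp
  next
    case False
    have "\<not> i < length (head_block n 1)"
    proof
      assume i: "i < length (head_block n 1)"
      then have "head_block n 1 ! i \<in> {..2 * n}"
        using set_head_block[of n 1] nth_mem by blast
      with False i show False by (simp add: V nth_append)
    qed
    then have "take i (Vword k m ls n) = head_block n 1 @ take (i - length (head_block n 1)) ((2 * n + 1) # rest)"
      by (simp add: V)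
    then have ge: "W (take i (Vword k m ls n)) \<ge> W (head_block n 1)"
      using W_nonneg by simp
    have "Vword k m ls n ! i \<in> {..2 * n + 1}"
      using nth_mem[OF assms(2)] rest set_head_block[of n 1] by (auto simp: V)
    then have le: "weight p k (Vword k m ls n ! i) \<le> weight p k (2 * n + 1)"
      using kp by (intro weight_mono) simp_all
    have "ratio (length (prefix n) + i) \<le> ratio_odd n"
      unfolding eq ratio_odd_def
      by (rule frac_le) (use pos ge le weight_ge_1[OF kp, of "2 * n + 1"] W_nonneg[of "head_block n 1"] in linarith)+
    then show ?thesis by simp
  qed
qed

section \<open>Limits of the two extremal ratios\<close>

definition lim_even :: real where
  "lim_even = (real p - 1) * (real p - 2 * real k + 1) * (1 / total)"

text \<open>Once \<open>total\<close> is identified with \<nu>1, the denominator is \<nu>2.\<close>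

definition lim_odd :: real where
  "lim_odd = (real p - 1) * (real p - 2 * real k + 1) *
     (real p / (total + real (ls 1) * ((real p)\<^sup>2 - 1) - 2 * real k * (real p - 1)))"

lemma inverse_pow_tendsto: "(\<lambda>n. inverse ((real p)\<^sup>2 ^ n)) \<longlonglongrightarrow> 0"
  using p_sq_gt_1 by (rule LIMSEQ_inverse_realpow_zero)

text \<open>Numerator and denominator are both divided by p^(2n), which leaves a rational expression
  in z = p^(-2n), continuous at z = 0.\<close>

lemma ratio_even_tendsto: "ratio_even \<longlonglongrightarrow> lim_even"
proof -
  define z where "z = (\<lambda>n. inverse ((real p)\<^sup>2 ^ n))"
  define u v w where "u = (real p + 1 - 2 * real k) / (real p + 1)"
    and "v = 2 * real k / (real p + 1)" and "w = total / ((real p)\<^sup>2 - 1)"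
  have w: "w > 0" using total_gt_1 p_sq_gt_1 by (simp add: w_def)
  have eq: "ratio_even n = (u + v * z n) / (w * (1 - z n) - z n)" for n
  proof -
    define y where "y = (real p)\<^sup>2 ^ n"
    have y: "y > 0" and yz: "y * z n = 1" using p_gt_1 by (simp_all add: y_def z_def)
    have "weight p k (2 * n) = u * y + v"
      by (simp add: weight_even u_def v_def y_def add_divide_distrib)
    also have "\<dots> = u * y + v * (y * z n)" using yz by simp
    also have "\<dots> = y * (u + v * z n)" by (simp add: algebra_simps)
    finally have num: "weight p k (2 * n) = y * (u + v * z n)" .
    have "W (prefix n) - 1 = w * (y - 1) - 1"
      by (simp add: W_prefix w_def y_def)
    also have "\<dots> = w * (y - y * z n) - y * z n" using yz by simp
    also have "\<dots> = y * (w * (1 - z n) - z n)" by (simp add: algebra_simps)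
    finally show ?thesis using y num by (simp add: ratio_even_def)
  qed
  \<comment> \<open>Gives \<open>u\<close> the denominator of \<open>w\<close>, so that it cancels
    in the limit u/w.\<close>
  have u': "u = (real p + 1 - 2 * real k) * (real p - 1) / ((real p)\<^sup>2 - 1)"
    using p_gt_1 by (simp add: u_def p_sq)
  have z: "z \<longlonglongrightarrow> 0" unfolding z_def by (rule inverse_pow_tendsto)
  have "(\<lambda>n. (u + v * z n) / (w * (1 - z n) - z n)) \<longlonglongrightarrow> (u + v * 0) / (w * (1 - 0) - 0)"
    using w by (intro tendsto_intros z) simp_all
  also have "(u + v * 0) / (w * (1 - 0) - 0) = lim_even"
    unfolding u' w_def lim_even_def using p_sq_gt_1 by (simp add: diff_add_eq mult.commute)
  finally show ?thesis by (simp add: eq[abs_def])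
qed

text \<open>From 2k < p + 1 and l_1 \<ge> 1, the term l_1 (p^2 - 1) already dominates 2k (p -
  1).\<close>

lemma odd_denominator_pos: "total + real (ls 1) * ((real p)\<^sup>2 - 1) - 2 * real k * (real p - 1) > 0"
proof -
  note p1 = p_gt_1
  have "2 * real k * (real p - 1) \<le> (real p + 1) * (real p - 1)"
    using kp p1 by (intro mult_right_mono) linarith+
  also have "\<dots> \<le> real (ls 1) * ((real p + 1) * (real p - 1))"
    using ls_ge[of 1] m_ge p1 mult_right_mono[of 1 "real (ls 1)" "(real p + 1) * (real p - 1)"] by simp
  finally show ?thesis using total_gt_1 by (simp add: p_sq mult.commute)
qed

lemma ratio_odd_tendsto: "ratio_odd \<longlonglongrightarrow> lim_odd"
proof -
  define z where "z = (\<lambda>n. inverse ((real p)\<^sup>2 ^ n))"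
  define u v w where "u = (real p + 1 - 2 * real k) / (real p + 1)"
    and "v = 2 * real k / (real p + 1)" and "w = total / ((real p)\<^sup>2 - 1)"
  define D where "D = total + real (ls 1) * ((real p)\<^sup>2 - 1) - 2 * real k * (real p - 1)"
  have D: "D > 0" using odd_denominator_pos by (simp add: D_def)
  have u': "u = (real p + 1 - 2 * real k) * (real p - 1) / ((real p)\<^sup>2 - 1)"
    using p_gt_1 by (simp add: u_def p_sq)
  \<comment> \<open>Scaled by p^2 - 1, the term \<open>u\<close> becomes (p^2 - 1) - 2k (p - 1),
    which completes l_1 - 1 to l_1.\<close>
  have den: "w + (real (ls 1) - 1) + u = D / ((real p)\<^sup>2 - 1)"
  proof -
    have "D = total + (real (ls 1) - 1) * ((real p)\<^sup>2 - 1) + (real p + 1 - 2 * real k) * (real p - 1)"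
      by (simp add: D_def power2_eq_square algebra_simps)
    then show ?thesis
      unfolding u' w_def using p_sq_gt_1 by (simp add: add_divide_distrib)
  qed
  have eq: "ratio_odd n = (u * real p - v * z n) / (w * (1 - z n) + (real (ls 1) - 1) + (u + v * z n) - z n)"
    if "n \<ge> 1" for n
  proof -
    define y where "y = (real p)\<^sup>2 ^ n"
    have y: "y > 0" and yz: "y * z n = 1" using p_gt_1 by (simp_all add: y_def z_def)
    have "weight p k (2 * n + 1) = u * real p * y - v"
      unfolding weight_odd u_def v_def y_def diff_divide_distrib[of "_ * _ * _"] by simp
    also have "\<dots> = u * real p * y - v * (y * z n)" using yz by simp
    also have "\<dots> = y * (u * real p - v * z n)" by (simp add: algebra_simps)
    finally have num: "weight p k (2 * n + 1) = y * (u * real p - v * z n)" .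
    have "W (prefix n) + W (head_block n 1) - 1 = w * (y - 1) + ((real (ls 1) - 1) * y + (u * y + v)) - 1"
      using W_head_block[of n 1] that m_ge
      by (simp add: W_prefix weight_even w_def u_def v_def y_def add_divide_distrib)
    also have "\<dots> = w * (y - y * z n) + ((real (ls 1) - 1) * y + (u * y + v * (y * z n))) - y * z n"
      using yz by simp
    also have "\<dots> = y * (w * (1 - z n) + (real (ls 1) - 1) + (u + v * z n) - z n)"
      by (simp add: algebra_simps)
    finally show ?thesis using y num by (simp add: ratio_odd_def)
  qed
  have z: "z \<longlonglongrightarrow> 0" unfolding z_def by (rule inverse_pow_tendsto)
  have "(\<lambda>n. (u * real p - v * z n) / (w * (1 - z n) + (real (ls 1) - 1) + (u + v * z n) - z n))
      \<longlonglongrightarrow> (u * real p - v * 0) / (w * (1 - 0) + (real (ls 1) - 1) + (u + v * 0) - 0)"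
    using D p_sq_gt_1 den by (intro tendsto_intros z) simp_all
  also have "(u * real p - v * 0) / (w * (1 - 0) + (real (ls 1) - 1) + (u + v * 0) - 0)
      = u * real p / (D / ((real p)\<^sup>2 - 1))"
    by (simp add: den del: One_nat_def)
  also have "\<dots> = lim_odd"
    unfolding u' lim_odd_def D_def[symmetric] using D p_sq_gt_1
    by (simp add: diff_add_eq mult.commute mult.left_commute)
  finally show ?thesis
    by (rule Lim_transform_eventually) (auto intro!: eventually_sequentiallyI[of 1] simp: eq)
qed

section \<open>The limit superior of the ratios along the word\<close>

lemma length_prefix_mono: "i \<le> j \<Longrightarrow> length (prefix i) \<le> length (prefix j)"
  by (rule lift_Suc_mono_le[of "\<lambda>n. length (prefix n)"]) (simp_all add: prefix_def)

lemma length_prefix_ge: "n \<le> length (prefix n)"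
proof (induction n)
  case (Suc n)
  have "length (Vword k m ls n) \<ge> 1" using Vword_nonempty[of n] by (simp add: Suc_leI)
  with Suc show ?case by (simp add: prefix_def)
qed simp

lemma limsup_ratio: "limsup (\<lambda>j. ereal (2 + ratio j)) = 2 + ereal (max lim_even lim_odd)"
proof (rule antisym)
  have two: "2 + ereal x = ereal (2 + x)" for x by simp
  have "\<forall>j. \<exists>n i. j = length (prefix n) + i \<and> i < length (Vword k m ls n)"
    using block_position[of "Vword k m ls"] Vword_nonempty by (simp add: prefix_def)
  then obtain N I where NI: "\<And>j. j = length (prefix (N j)) + I j" "\<And>j. I j < length (Vword k m ls (N j))"
    by metis
  \<comment> \<open>The block containing position j moves off to infinity with j, so bounds per
    block turn into a bound on the limit superior.\<close>
  have N_ge: "n \<le> N j" if "length (prefix n) \<le> j" for n j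
  proof (rule ccontr)
    assume "\<not> n \<le> N j"
    then have "length (prefix (Suc (N j))) \<le> length (prefix n)" by (intro length_prefix_mono) simp
    then show False using that NI[of j] by (simp add: prefix_def)
  qed
  have N: "filterlim N at_top sequentially"
    unfolding filterlim_at_top eventually_sequentially using N_ge by blast
  have lim: "(\<lambda>n. ereal (2 + max (ratio_even n) (ratio_odd n))) \<longlonglongrightarrow> ereal (2 + max lim_even lim_odd)"
    by (intro tendsto_ereal tendsto_intros tendsto_max ratio_even_tendsto ratio_odd_tendsto)
  have "limsup (\<lambda>j. ereal (2 + ratio j)) \<le> limsup (\<lambda>j. ereal (2 + max (ratio_even (N j)) (ratio_odd (N j))))"
  proof (rule Limsup_mono, rule eventually_sequentiallyI[of "length (prefix 1)"])
    fix j assume "length (prefix 1) \<le> j"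
    then have "1 \<le> N j" by (rule N_ge)
    from ratio_le[OF this NI(2)] show "ereal (2 + ratio j) \<le> ereal (2 + max (ratio_even (N j)) (ratio_odd (N j)))"
      by (simp add: NI(1)[symmetric])
  qed
  also have "\<dots> \<le> limsup (\<lambda>n. ereal (2 + max (ratio_even n) (ratio_odd n)))"
    using N by (rule Limsup_filterlim_le)
  also have "\<dots> = ereal (2 + max lim_even lim_odd)"
    using lim by (intro lim_imp_Limsup) simp_all
  finally show "limsup (\<lambda>j. ereal (2 + ratio j)) \<le> 2 + ereal (max lim_even lim_odd)"
    unfolding two .
next
  \<comment> \<open>Lower bound from a subsequence, applied to the starts of the V_n and to the
    first letters 2n + 1.\<close>
  have sub: "ereal (2 + x) \<le> limsup (\<lambda>j. ereal (2 + ratio j))"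
    if h: "\<And>n. h n \<ge> n" and r: "\<And>n. n \<ge> 1 \<Longrightarrow> ratio (h n) = r n" and lim: "r \<longlonglongrightarrow> x"
    for h :: "nat \<Rightarrow> nat" and r x
  proof -
    have "filterlim h at_top sequentially"
      using h by (intro filterlim_at_top_mono[OF filterlim_ident]) simp
    then have "limsup (\<lambda>n. ereal (2 + ratio (h n))) \<le> limsup (\<lambda>j. ereal (2 + ratio j))"
      by (rule Limsup_filterlim_le)
    moreover have "limsup (\<lambda>n. ereal (2 + ratio (h n))) = limsup (\<lambda>n. ereal (2 + r n))"
      using r by (intro Limsup_eq eventually_sequentiallyI[of 1]) simp
    moreover have "limsup (\<lambda>n. ereal (2 + r n)) = ereal (2 + x)"
      by (intro lim_imp_Limsup tendsto_ereal tendsto_intros lim) simp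
    ultimately show ?thesis by simp
  qed
  have "ereal (2 + lim_even) \<le> limsup (\<lambda>j. ereal (2 + ratio j))"
    by (rule sub[OF length_prefix_ge ratio_even_eq ratio_even_tendsto])
  moreover have "ereal (2 + lim_odd) \<le> limsup (\<lambda>j. ereal (2 + ratio j))"
    by (rule sub[OF _ ratio_odd_eq ratio_odd_tendsto]) (intro trans_le_add1 length_prefix_ge, simp)
  ultimately show "2 + ereal (max lim_even lim_odd) \<le> limsup (\<lambda>j. ereal (2 + ratio j))"
    by (simp add: max_def)
qed

end

section \<open>The irrationality measure of the perfect expansion\<close>

theorem mainTheorem2:
  fixes t :: real and p k m l :: nat and ns ls :: "nat \<Rightarrow> nat"
    and \<alpha> :: "'p::prime_card mod_ring fls"
    and a :: "nat \<Rightarrow> 'p mod_ring poly"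
    and \<epsilon>1 \<epsilon>2 :: "'p mod_ring"
    and lam :: "nat \<Rightarrow> 'p mod_ring"
    and \<nu>1 \<nu>2 \<nu>0 :: real
  assumes "t > 1"
    and "p = CARD('p)" and "odd p"
    and "1 \<le> k" and "real k < real p / 2"
    and "m \<ge> 1"
    and "1 < ns 1"
    and "\<forall>i. 1 \<le> i \<and> i < m \<longrightarrow> ns i < ns (i + 1) \<and> ns (i + 1) - ns i \<ge> 3"
    and "l = ns m"
    and "ls 1 = ns 1 - 1"
    and "\<forall>i. 1 \<le> i \<and> i < m \<longrightarrow> ls (i + 1) = ns (i + 1) - ns i - 1"
    and "has_cf t \<alpha> a"
    and "expansion_second_kind t k (map a [1..<Suc l]) \<epsilon>1 \<epsilon>2 \<alpha>"
    and "\<forall>n\<ge>1. lam n \<noteq> 0 \<and> a n = smult (lam n) (Bpol k (letter k m ls n))"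
    and "\<nu>1 = real m * (real p - 2 * real k - 1) + real l"
    and "\<nu>2 = \<nu>1 + real (ls 1) * ((real p)\<^sup>2 - 1) - 2 * real k * (real p - 1)"
    and "\<nu>0 = (real p - 1) * (real p - 2 * real k + 1) * max (1 / \<nu>1) (real p / \<nu>2)"
  shows "irrationality_measure t \<alpha> = 2 + ereal \<nu>0 \<and>
    (m = 1 \<and> l = 2 \<longrightarrow> \<nu>0 = real p - 1) \<and>
    (\<not> (m = 1 \<and> l = 2) \<longrightarrow> \<nu>0 < real p - 1)"
proof -
  have kp: "2 * k < p" using assms(5) by linarith
  have gap: "ns i + 3 \<le> ns (i + 1)" and ls_Suc: "ls (i + 1) = ns (i + 1) - ns i - 1"
    if "1 \<le> i" "i < m" for i
    using assms(8,11) that by force+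
  interpret block_word p k m ls
  proof
    fix i assume i: "1 \<le> i" "i \<le> m"
    show "1 \<le> ls i"
    proof (cases "i = 1")
      case False
      with i obtain j where j: "i = j + 1" "1 \<le> j" "j < m"
        by (metis Suc_eq_plus1 Suc_le_lessD le_add_diff_inverse2 le_neq_implies_less less_Suc_eq_le)
      then show ?thesis using gap[of j] ls_Suc[of j] by simp
    qed (use assms(7,10) in simp)
  qed (use assms(4,6) kp in simp_all)
  \<comment> \<open>The gaps telescope; each l_i leaves out one unit, which the summand j restores.
    At j = m this yields \<nu>1 as the weight of V_0.\<close>
  have sum_ls: "(\<Sum>i=1..j. real (ls i)) + real j = real (ns j)" if "1 \<le> j" "j \<le> m" for j
    using that
  proof (induction j rule: dec_induct)
    case base
    then show ?case using assms(7,10) by (simp add: of_nat_diff)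
  next
    case (step j)
    have "real (ls (Suc j)) = real (ns (Suc j)) - real (ns j) - 1"
      using gap[of j] ls_Suc[of j] step by (simp add: of_nat_diff)
    with step show ?case by simp
  qed
  have total: "total = \<nu>1"
  proof -
    have "total = (\<Sum>i=1..m. real (ls i)) + real m * (real p - 2 * real k)"
      by (simp add: total_def sum.distrib sum_subtractf algebra_simps)
    then show ?thesis
      using sum_ls[of m] assms(6,9) unfolding assms(15) by (simp add: algebra_simps)
  qed
  have \<nu>0: "\<nu>0 = max lim_even lim_odd"
  proof -
    have "(real p - 1) * (real p - 2 * real k + 1) \<ge> 0"
      using kp p_gt_1 by (intro mult_nonneg_nonneg) linarith+
    then show ?thesis
      by (simp add: lim_even_def lim_odd_def assms(16,17) total max_mult_distrib_left)
  qed

  have irr: "irrational \<alpha>" and pq: "\<And>n. n \<ge> 1 \<Longrightarrow> a n = partial_quotient \<alpha> n"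
    using assms(12) by (simp_all add: has_cf_def)
  have deg: "real (degree (partial_quotient \<alpha> (Suc n))) = weight p k (word !! n)" for n
  proof -
    have "partial_quotient \<alpha> (Suc n) = smult (lam (Suc n)) (Bpol k (word !! n))" "lam (Suc n) \<noteq> 0"
      using assms(14) pq[of "Suc n"] by (auto simp: letter_def word_def)
    then show ?thesis
      using degree_Bpol[where 'p = 'p, of k "word !! n"] kp assms(2) by simp
  qed
  have sum_deg: "real (\<Sum>i=2..n. degree (partial_quotient \<alpha> i)) = W (stake n word) - 1" if "n \<ge> 1" for n
    using that
  proof (induction n rule: dec_induct)
    case base
    \<comment> \<open>The first letter is 0, of weight 1, and cancels the subtracted 1; the sum from
      2 to 1 is empty.\<close>
    obtain rest where "Vword k m ls 0 = 0 # rest" by (rule Vword_0)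
    then have "word !! 0 = 0" using snth_word[of 0 0] by (simp add: prefix_def)
    then show ?case by simp
  next
    case (step n)
    then show ?case unfolding sum_list_stake by (simp add: deg)
  qed
  have "irrationality_measure t \<alpha> = limsup (\<lambda>n. ereal (2 + ratio n))"
    unfolding irrationality_measure_partial_quotients[OF assms(1) irr]
    by (intro Limsup_eq eventually_sequentiallyI[of 1]) (simp only: ratio_def deg sum_deg)
  then have measure: "irrationality_measure t \<alpha> = 2 + ereal \<nu>0"
    unfolding \<nu>0 limsup_ratio .

  \<comment> \<open>The value of \<nu>1 when m = 1 and l = 2. There \<nu>2 = p c, so both terms of
    the maximum equal 1/c; otherwise \<nu>1 > c and \<nu>2 > p c strictly.\<close>
  define c where "c = real p - 2 * real k + 1"
  have c: "c > 0" using kp by (simp add: c_def)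
  have special: "\<nu>0 = real p - 1" if "m = 1" "l = 2"
  proof -
    have l1: "ls 1 = 1" using that assms(9,10) by simp
    have n1: "\<nu>1 = c" unfolding assms(15) that c_def by simp
    have n2: "\<nu>2 = real p * c"
      unfolding assms(16) n1 l1 by (simp add: c_def power2_eq_square algebra_simps)
    show ?thesis
      unfolding assms(17) n1 n2 c_def[symmetric] using c p_gt_1 by simp
  qed
  have generic: "\<nu>0 < real p - 1" if "\<not> (m = 1 \<and> l = 2)"
  proof -
    have n1: "\<nu>1 > c"
    proof (cases "m = 1")
      case True
      with that have "l > 2" using assms(7,9) by simp
      then show ?thesis unfolding assms(15) True c_def by simp
    next
      case False
      with assms(6) have m: "m \<ge> 2" by simp
      \<comment> \<open>Here 5 = 2 + 3, from n_1 \<ge> 2 and at least one gap of at least 3; more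
        than 2 is what \<nu>1 > c requires.\<close>
      have "real (ns m) \<ge> 5"
      proof -
        have "ns 1 + 3 \<le> ns j" if "2 \<le> j" "j \<le> m" for j
          using that
        proof (induction j rule: dec_induct)
          case base
          then show ?case using gap[of 1] m by (simp add: numeral_2_eq_2)
        next
          case (step j)
          then show ?case using gap[of j] by simp
        qed
        from this[of m] m show ?thesis using assms(7) by simp
      qed
      moreover have "1 * (real p - 2 * real k - 1) \<le> real m * (real p - 2 * real k - 1)"
        using kp assms(6) by (intro mult_right_mono) linarith+
      ultimately show ?thesis unfolding assms(15) assms(9) c_def by simp
    qed
    have n2: "\<nu>2 > real p * c"
    proof -
      have "real (ls 1) \<ge> 1" using ls_ge[of 1] assms(6) by simp
      then have "1 * ((real p)\<^sup>2 - 1) \<le> real (ls 1) * ((real p)\<^sup>2 - 1)"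
        using p_sq_gt_1 by (intro mult_right_mono) simp_all
      with n1 have "\<nu>2 > c + ((real p)\<^sup>2 - 1) - 2 * real k * (real p - 1)"
        unfolding assms(16) by simp
      also have "c + ((real p)\<^sup>2 - 1) - 2 * real k * (real p - 1) = real p * c"
        by (simp add: c_def power2_eq_square algebra_simps)
      finally show ?thesis .
    qed
    have pc: "real p * c > 0" using c p_gt_1 by simp
    have "max (1 / \<nu>1) (real p / \<nu>2) < 1 / c"
    proof -
      have "1 / \<nu>1 < 1 / c" using n1 c by (intro divide_strict_left_mono) simp_all
      moreover have "real p / \<nu>2 < real p / (real p * c)"
        using n2 pc p_gt_1 by (intro divide_strict_left_mono) simp_all
      ultimately show ?thesis using p_gt_1 by simp
    qed
    then have "\<nu>0 < (real p - 1) * c * (1 / c)"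
      unfolding assms(17) c_def[symmetric] using c p_gt_1 by (intro mult_strict_left_mono) simp_all
    then show ?thesis using c by simp
  qed
  from measure special generic show ?thesis by blast
qed

end
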